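(* Let $n\ge2$, $\nu>0$, $\beta_1,\dots,\beta_n>0$ and $\bar\beta=\beta_1+\dots+\beta_n$. Then \begin{align*} \int_0^1\mathrm dq_1\cdots\int_0^{1-q_1-\cdots-q_{n-2}}\mathrm dq_{n-1}&\left(\prod_{i=1}^{n-1}q_i^{\nu\beta_i-1}\right)\left(1-\sum_{i=1}^{n-1}q_i\right)^{\nu\beta_n-1}\\ &\times\biggl(q_1^\nu+\cdots+q_{n-1}^\nu+\Bigl(1-\sum_{i=1}^{n-1}q_i\Bigr)^\nu\biggr)^{-\bar\beta}=\frac{\Gamma(\beta_1)\cdots\Gamma(\beta_n)}{\nu^{n-1}\,\Gamma(\bar\beta)}. \end{align*}
   Context: The integral is over the simplex $\{(q_1,\dots,q_{n-1}):q_i>0,\ q_1+\dots+q_{n-1}<1\}$ (for $n=2$ it is a single integral over $(0,1)$). *)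

theory Defs
  imports "HOL-Analysis.Analysis"
begin

text \<open>
  Points of \<open>\<real>\<^sup>m\<close>, with coordinates indexed by \<open>1, \<dots>, m\<close>, are the elements of
  the space of the product measure below, i.e. functions that are \<open>undefined\<close> off \<open>{1..m}\<close>.
\<close>

abbreviation lborel_n :: "nat \<Rightarrow> (nat \<Rightarrow> real) measure" where
  "lborel_n m \<equiv> PiM {1..m} (\<lambda>_. lborel)"

definition open_simplex :: "nat \<Rightarrow> (nat \<Rightarrow> real) set" where
  "open_simplex m =
     {q \<in> space (lborel_n m). (\<forall>i\<in>{1..m}. 0 < q i) \<and> (\<Sum>i=1..m. q i) < 1}"

end

theory Submission
  imports Defs
begin

text \<open>
  Write \<open>B\<close> for the sum of the \<open>\<beta> i\<close>. The product of the \<open>n\<close> integrals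
  \<open>\<integral>\<^sub>0\<^sup>\<infinity> y powr (\<nu> * \<beta> i - 1) * exp (- (y powr \<nu>)) dy = Gamma (\<beta> i) / \<nu>\<close> is evaluated in the
  coordinates \<open>y i = r * q i\<close>, where \<open>r\<close> is the sum of the \<open>y i\<close> and \<open>q\<close> lies in the simplex. The
  integrand becomes \<open>r powr (\<nu> * B - 1) * exp (- (S q * r powr \<nu>))\<close> times a function of \<open>q\<close>, where
  \<open>S q\<close> is the sum of the \<open>q i powr \<nu>\<close>, and integrating out \<open>r\<close> leaves
  \<open>Gamma B / \<nu> * S q powr (- B)\<close>. The change of coordinates is a shift of the last variable, an
  exchange of integrals and a dilation of the others; with nonnegative integrals, no
  integrability has to be checked.
\<close>

text \<open>Euler's integral for \<open>Gamma a\<close> under the substitution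
  \<open>t = S * r powr \<nu>\<close>. The factor \<open>S\<close> is kept general because the
  radial integral at a point \<open>q\<close> of the simplex has the constant \<open>S q\<close> in
  its exponent.\<close>

lemma has_integral_powr_exp_powr:
  fixes a \<nu> S :: real
  assumes a: "a > 0" and \<nu>: "\<nu> > 0" and S: "S > 0"
  shows "((\<lambda>r. r powr (\<nu> * a - 1) * exp (- (S * r powr \<nu>))) has_integral
            Gamma a * S powr (- a) / \<nu>) {0<..}"
proof -
  let ?f = "\<lambda>t::real. t powr (a - 1) / exp t"
  let ?g = "\<lambda>r::real. S * r powr \<nu>"
  let ?g' = "\<lambda>r::real. S * (\<nu> * r powr (\<nu> - 1))"
  have f: "(?f has_integral Gamma a) {0<..}"
  proof -
    \<comment> \<open>The known integral runs over \<open>{0..}\<close>; changing the integrand at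
      the single point 0 passes to the open half-line, on which the substitution is
      differentiable.\<close>
    have "((\<lambda>t. if t \<in> {0<..} then ?f t else 0) has_integral Gamma a) {0..}"
      by (rule has_integral_spike_finite[OF _ _ Gamma_integral_real[OF a], of "{0}"]) auto
    then show ?thesis
      by (subst (asm) has_integral_restrict) auto
  qed
  have f': "?f absolutely_integrable_on {0<..} \<and> integral {0<..} ?f = Gamma a"
    using f by (auto intro!: nonnegative_absolutely_integrable_1 simp: has_integral_iff)
  have der: "(?g has_field_derivative ?g' x) (at x within {0<..})" if "x \<in> {0<..}" for x
    using that by (auto intro!: derivative_eq_intros)
  have inj: "inj_on ?g {0<..}"
    using \<nu> S by (auto intro!: inj_onI) (metis linorder_neqE less_irrefl less_imp_le powr_less_mono2)
  have img: "?g ` {0<..} = {0<..}"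
  proof (intro equalityI subsetI)
    fix t :: real assume "t \<in> {0<..}"
    \<comment> \<open>The witness is the inverse of the substitution.\<close>
    then have "t = ?g ((t / S) powr (1 / \<nu>))" "(t / S) powr (1 / \<nu>) \<in> {0<..}"
      using \<nu> S by (auto simp: powr_powr)
    then show "t \<in> ?g ` {0<..}" by blast
  qed (use S in auto)
  have "((\<lambda>x. \<bar>?g' x\<bar> * ?f (?g x)) has_integral Gamma a) {0<..}"
    using has_absolute_integral_change_of_variables_1'[OF _ der inj, of ?f "Gamma a"] f' img
    by (auto simp: has_integral_iff dest!: set_lebesgue_integral_eq_integral(1))
  then have "((\<lambda>x. S powr (- a) / \<nu> * (\<bar>?g' x\<bar> * ?f (?g x))) has_integral
      S powr (- a) / \<nu> * Gamma a) {0<..}"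
    by (rule has_integral_mult_right)
  moreover have "S powr (- a) / \<nu> * (\<bar>?g' x\<bar> * ?f (?g x)) =
      x powr (\<nu> * a - 1) * exp (- (S * x powr \<nu>))" if "x \<in> {0<..}" for x
  proof -
    \<comment> \<open>The derivative contributes one factor \<open>S\<close> and the integrand
      \<open>S powr (a - 1)\<close>; the prefactor \<open>S powr (- a) / \<nu>\<close> cancels these
      and the \<open>\<nu>\<close> of the derivative.\<close>
    have "S powr (- a) * (S * S powr (a - 1)) = 1"
      using S by (simp add: powr_mult_base flip: powr_add)
    moreover have "x powr (\<nu> - 1) * x powr (\<nu> * (a - 1)) = x powr (\<nu> * a - 1)"
      by (simp add: algebra_simps flip: powr_add)
    ultimately show ?thesis
      using that S \<nu> by (simp add: powr_mult powr_powr exp_minus field_simps)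
  qed
  ultimately show ?thesis
    by (subst has_integral_cong[of _ _ "\<lambda>x. S powr (- a) / \<nu> * (\<bar>?g' x\<bar> * ?f (?g x))"])
       (auto simp: mult_ac)
qed

lemma nn_integral_powr_exp_powr:
  fixes a \<nu> S :: real
  assumes "a > 0" "\<nu> > 0" "S > 0"
  shows "(\<integral>\<^sup>+r. ennreal (indicator {0<..} r * (r powr (\<nu> * a - 1) * exp (- (S * r powr \<nu>)))) \<partial>lborel) =
           ennreal (Gamma a * S powr (- a) / \<nu>)"
  by (intro nn_integral_has_integral_lebesgue has_integral_powr_exp_powr assms) auto

text \<open>Each coordinate contributes one factor \<open>c\<close>: in the induction the new
  coordinate is integrated out into \<open>g\<close>, the hypothesis scales the others, and the
  one-dimensional affine substitution scales the new one. The restriction to \<open>I\<close> keeps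
  the scaled point \<open>undefined\<close> off \<open>I\<close>.\<close>

lemma nn_integral_PiM_lborel_scale:
  fixes c :: real and f :: "('i \<Rightarrow> real) \<Rightarrow> ennreal"
  assumes "finite I" and c: "c > 0" and "f \<in> borel_measurable (PiM I (\<lambda>_. lborel))"
  shows "(\<integral>\<^sup>+x. f x \<partial>PiM I (\<lambda>_. lborel)) =
           ennreal (c ^ card I) * (\<integral>\<^sup>+x. f (\<lambda>i\<in>I. c * x i) \<partial>PiM I (\<lambda>_. lborel))"
  using assms(1,3)
proof (induction I arbitrary: f)
  case empty
  then show ?case
    by (simp add: PiM_empty nn_integral_count_space_finite restrict_def)
next
  case (insert i I)
  interpret product_sigma_finite "\<lambda>_::'i. lborel :: real measure"
    by standard
  note [measurable] = insert.prems
  note insert.hyps[simp]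
  define g where "g = (\<lambda>x. \<integral>\<^sup>+y. f (x(i := y)) \<partial>lborel)"
  have [measurable]: "g \<in> borel_measurable (PiM I (\<lambda>_. lborel))"
    unfolding g_def by measurable
  have "(\<integral>\<^sup>+x. f x \<partial>PiM (insert i I) (\<lambda>_. lborel)) = (\<integral>\<^sup>+x. g x \<partial>PiM I (\<lambda>_. lborel))"
    unfolding g_def by (intro product_nn_integral_insert) auto
  also have "\<dots> = ennreal (c ^ card I) * (\<integral>\<^sup>+x. g (\<lambda>j\<in>I. c * x j) \<partial>PiM I (\<lambda>_. lborel))"
    by (rule insert.IH) simp
  also have "(\<integral>\<^sup>+x. g (\<lambda>j\<in>I. c * x j) \<partial>PiM I (\<lambda>_. lborel)) =
      (\<integral>\<^sup>+x. ennreal c * (\<integral>\<^sup>+y. f (\<lambda>j\<in>insert i I. c * (x(i := y)) j) \<partial>lborel) \<partial>PiM I (\<lambda>_. lborel))"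
  proof (rule nn_integral_cong)
    fix x :: "'i \<Rightarrow> real" assume x: "x \<in> space (PiM I (\<lambda>_. lborel))"
    have 1: "(\<lambda>j\<in>I. c * x j) \<in> space (PiM I (\<lambda>_. lborel))"
      by (simp add: space_PiM)
    have meas: "(\<lambda>y. f ((\<lambda>j\<in>I. c * x j)(i := y))) \<in> borel_measurable borel"
      using measurable_compose[OF measurable_component_update[OF 1 insert.hyps(2)] insert.prems]
      by (simp only: measurable_lborel1 measurable_lborel2)
    have "(\<lambda>j\<in>I. c * x j)(i := 0 + c * y) = (\<lambda>j\<in>insert i I. c * (x(i := y)) j)" for y
      by (auto simp: restrict_def)
    then show "g (\<lambda>j\<in>I. c * x j) = ennreal c * (\<integral>\<^sup>+y. f (\<lambda>j\<in>insert i I. c * (x(i := y)) j) \<partial>lborel)"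
      unfolding g_def using nn_integral_real_affine[OF meas, of c 0] c
      by (simp only: abs_of_pos less_imp_neq[symmetric] not_False_eq_True simp_thms)
  qed
  also have "\<dots> = ennreal c * (\<integral>\<^sup>+x. \<integral>\<^sup>+y. f (\<lambda>j\<in>insert i I. c * (x(i := y)) j) \<partial>lborel \<partial>PiM I (\<lambda>_. lborel))"
    by (rule nn_integral_cmult) measurable
  also have "(\<integral>\<^sup>+x. \<integral>\<^sup>+y. f (\<lambda>j\<in>insert i I. c * (x(i := y)) j) \<partial>lborel \<partial>PiM I (\<lambda>_. lborel)) =
      (\<integral>\<^sup>+x. f (\<lambda>j\<in>insert i I. c * x j) \<partial>PiM (insert i I) (\<lambda>_. lborel))"
    by (intro product_nn_integral_insert[symmetric]) auto
  also have "ennreal (c ^ card I) * (ennreal c * X) = ennreal (c ^ card (insert i I)) * X" for X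
    using c by (simp add: ennreal_mult' mult_ac)
  finally show ?case .
qed

text \<open>Extension by zero to the whole line lets the last variable be shifted without tracking
  limits of integration; the constraints of the simplex later come out of the indicators.\<close>

definition gamma_kernel :: "real \<Rightarrow> real \<Rightarrow> real \<Rightarrow> real" where
  "gamma_kernel \<nu> a y = indicator {0<..} y * (y powr (\<nu> * a - 1) * exp (- (y powr \<nu>)))"

lemma gamma_kernel_nonneg [simp]: "gamma_kernel \<nu> a y \<ge> 0"
  by (simp add: gamma_kernel_def)

lemma gamma_kernel_nonpos_eq_0 [simp]: "y \<le> 0 \<Longrightarrow> gamma_kernel \<nu> a y = 0"
  by (simp add: gamma_kernel_def)

lemma borel_measurable_gamma_kernel [measurable]: "gamma_kernel \<nu> a \<in> borel_measurable borel"
  unfolding gamma_kernel_def by measurable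

lemma nn_integral_gamma_kernel:
  assumes "a > 0" "\<nu> > 0"
  shows "(\<integral>\<^sup>+y. ennreal (gamma_kernel \<nu> a y) \<partial>lborel) = ennreal (Gamma a / \<nu>)"
  using nn_integral_powr_exp_powr[OF assms, of 1] by (simp add: gamma_kernel_def)

text \<open>Separates the dilation \<open>r\<close> from the point \<open>x\<close>. Every factor
  carries the exponent \<open>\<nu> * \<beta> i - 1\<close>, whence the \<open>- card I\<close> in
  the power of \<open>r\<close>; if some coordinate of \<open>x\<close> is not positive, both sides
  vanish.\<close>

lemma prod_gamma_kernel_scale:
  fixes \<beta> x :: "'i \<Rightarrow> real"
  assumes "finite I" and r: "r > 0"
  shows "(\<Prod>i\<in>I. gamma_kernel \<nu> (\<beta> i) (r * x i)) =
           r powr (\<nu> * (\<Sum>i\<in>I. \<beta> i) - card I) * exp (- ((\<Sum>i\<in>I. x i powr \<nu>) * r powr \<nu>)) *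
           (\<Prod>i\<in>I. indicator {0<..} (x i) * x i powr (\<nu> * \<beta> i - 1))"
  using assms(1)
proof induction
  case empty
  show ?case using r by simp
next
  case (insert i I)
  show ?case
  proof (cases "x i > 0")
    case True
    have "gamma_kernel \<nu> (\<beta> i) (r * x i) =
        r powr (\<nu> * \<beta> i - 1) * exp (- (x i powr \<nu> * r powr \<nu>)) * x i powr (\<nu> * \<beta> i - 1)"
      using True r by (simp add: gamma_kernel_def powr_mult mult_ac)
    moreover have "r powr (\<nu> * (\<Sum>i\<in>insert i I. \<beta> i) - card (insert i I)) =
        r powr (\<nu> * \<beta> i - 1) * r powr (\<nu> * (\<Sum>i\<in>I. \<beta> i) - card I)"
      using insert.hyps by (simp add: algebra_simps flip: powr_add)
    moreover have "exp (- ((\<Sum>i\<in>insert i I. x i powr \<nu>) * r powr \<nu>)) =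
        exp (- (x i powr \<nu> * r powr \<nu>)) * exp (- ((\<Sum>i\<in>I. x i powr \<nu>) * r powr \<nu>))"
      using insert.hyps by (simp add: algebra_simps flip: exp_add)
    ultimately show ?thesis
      using insert True by (simp add: mult_ac)
  next
    case False
    then have "gamma_kernel \<nu> (\<beta> i) (r * x i) = 0"
      using r by (intro gamma_kernel_nonpos_eq_0) (simp add: mult_nonneg_nonpos)
    then show ?thesis
      using insert.hyps False by simp
  qed
qed

theorem theorem3p1:
  fixes n :: nat and \<nu> :: real and \<beta> :: "nat \<Rightarrow> real"
  assumes "n \<ge> 2" and "\<nu> > 0" and "\<And>i. i \<in> {1..n} \<Longrightarrow> \<beta> i > 0"
  shows "(LINT q:open_simplex (n - 1)|lborel_n (n - 1).
            (\<Prod>i=1..n-1. q i powr (\<nu> * \<beta> i - 1))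
            * (1 - (\<Sum>i=1..n-1. q i)) powr (\<nu> * \<beta> n - 1)
            * ((\<Sum>i=1..n-1. q i powr \<nu>) + (1 - (\<Sum>i=1..n-1. q i)) powr \<nu>)
                powr (- (\<Sum>i=1..n. \<beta> i)))
         = (\<Prod>i=1..n. Gamma (\<beta> i)) / (\<nu> ^ (n - 1) * Gamma (\<Sum>i=1..n. \<beta> i))"
proof -
  note \<nu> = \<open>\<nu> > 0\<close> and \<beta> = assms(3)
  define m where "m = n - 1"
  define M where "M = lborel_n m"
  define B where "B = (\<Sum>i=1..n. \<beta> i)"
  define h where "h = (\<lambda>i. gamma_kernel \<nu> (\<beta> i))"
  define P where "P = (\<lambda>q::nat \<Rightarrow> real. (\<Prod>i=1..m. q i powr (\<nu> * \<beta> i - 1)) *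
    (1 - (\<Sum>i=1..m. q i)) powr (\<nu> * \<beta> n - 1))"
  define S where "S = (\<lambda>q::nat \<Rightarrow> real. (\<Sum>i=1..m. q i powr \<nu>) + (1 - (\<Sum>i=1..m. q i)) powr \<nu>)"
  have n: "n = Suc m" and n_set: "{1..n} = insert n {1..m}"
    using assms(1) by (auto simp: m_def)
  have B: "B > 0"
    unfolding B_def using assms(1) \<beta> by (intro sum_pos) auto
  interpret product_sigma_finite "\<lambda>_::nat. lborel :: real measure"
    by standard
  interpret M: sigma_finite_measure M
    unfolding M_def by (rule sigma_finite) simp
  interpret pair: pair_sigma_finite M lborel
    by standard
  have [measurable]: "(\<lambda>q. q i) \<in> borel_measurable M" if "i \<in> {1..m}" for i
    using that unfolding M_def by measurable
  have [measurable]: "h i \<in> borel_measurable borel" for i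
    unfolding h_def by measurable
  have [measurable]: "open_simplex m \<in> sets M"
    unfolding open_simplex_def M_def[symmetric] by measurable
  have [measurable]: "P \<in> borel_measurable M" "S \<in> borel_measurable M"
    unfolding P_def S_def by measurable
  have P_nonneg: "P q \<ge> 0" for q
    unfolding P_def by (intro mult_nonneg_nonneg prod_nonneg) auto
  have S_pos: "S q > 0" if "q \<in> open_simplex m" for q
    using that unfolding S_def open_simplex_def by (intro add_nonneg_pos sum_nonneg) auto

  have prod_h: "(\<Prod>i=1..n. ennreal (Gamma (\<beta> i) / \<nu>)) =
      (\<integral>\<^sup>+y. (\<Prod>i=1..m. ennreal (h i (y i))) \<partial>M) * (\<integral>\<^sup>+s. ennreal (h n s) \<partial>lborel)"
  proof -
    have "(\<integral>\<^sup>+s. ennreal (h i s) \<partial>lborel) = ennreal (Gamma (\<beta> i) / \<nu>)" if "i \<in> {1..n}" for i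
      unfolding h_def using that \<nu> \<beta> by (intro nn_integral_gamma_kernel) auto
    moreover have "(\<integral>\<^sup>+y. (\<Prod>i=1..m. ennreal (h i (y i))) \<partial>M) =
        (\<Prod>i=1..m. \<integral>\<^sup>+s. ennreal (h i s) \<partial>lborel)"
      unfolding M_def by (rule product_nn_integral_prod) auto
    ultimately show ?thesis
      unfolding n_set using n by (simp add: mult_ac)
  qed
  \<comment> \<open>For fixed \<open>y\<close> the last variable is written as \<open>r\<close>
    minus the sum of the others, so that \<open>r\<close> is the total of all \<open>n\<close>
    variables.\<close>
  also have "\<dots> = (\<integral>\<^sup>+y. \<integral>\<^sup>+r. (\<Prod>i=1..m. ennreal (h i (y i))) *
      ennreal (h n (r - (\<Sum>i=1..m. y i))) \<partial>lborel \<partial>M)"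
  proof -
    have "(\<integral>\<^sup>+s. ennreal (h n s) \<partial>lborel) = (\<integral>\<^sup>+r. ennreal (h n (r - t)) \<partial>lborel)" for t
      by (subst nn_integral_real_affine[where c = 1 and t = "- t"]) auto
    then show ?thesis
      by (simp add: nn_integral_cmult flip: nn_integral_multc)
  qed
  also have "\<dots> = (\<integral>\<^sup>+r. \<integral>\<^sup>+y. (\<Prod>i=1..m. ennreal (h i (y i))) *
      ennreal (h n (r - (\<Sum>i=1..m. y i))) \<partial>M \<partial>lborel)"
    by (rule pair.Fubini'[symmetric]) measurable
  also have "\<dots> = (\<integral>\<^sup>+r. \<integral>\<^sup>+q. ennreal (indicator (open_simplex m) q * P q *
      (indicator {0<..} r * (r powr (\<nu> * B - 1) * exp (- (S q * r powr \<nu>))))) \<partial>M \<partial>lborel)"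
  proof (rule nn_integral_cong)
    fix r :: real
    let ?F = "\<lambda>y. (\<Prod>i=1..m. ennreal (h i (y i))) * ennreal (h n (r - (\<Sum>i=1..m. y i)))"
    let ?G = "\<lambda>q. ennreal (indicator (open_simplex m) q * P q *
      (indicator {0<..} r * (r powr (\<nu> * B - 1) * exp (- (S q * r powr \<nu>)))))"
    show "(\<integral>\<^sup>+y. ?F y \<partial>M) = (\<integral>\<^sup>+q. ?G q \<partial>M)"
    proof (cases "r > 0")
      case False
      \<comment> \<open>If all \<open>y i\<close> are positive, the last kernel has the argument
        \<open>r - (\<Sum>i=1..m. y i) \<le> 0\<close>; otherwise one of the first \<open>m\<close>
        kernels vanishes.\<close>
      have zero: "?F y = 0" for y
      proof (cases "\<forall>i\<in>{1..m}. y i > 0")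
        case True
        then have "(\<Sum>i=1..m. y i) \<ge> 0"
          by (intro sum_nonneg) (auto intro: less_imp_le)
        then show ?thesis
          using False by (simp add: h_def)
      next
        case False
        then obtain i where "i \<in> {1..m}" "y i \<le> 0"
          by (auto simp: not_less)
        then have "(\<Prod>i=1..m. ennreal (h i (y i))) = 0"
          by (intro prod_zero bexI[of _ i]) (auto simp: h_def)
        then show ?thesis by simp
      qed
      have "(\<integral>\<^sup>+y. ?F y \<partial>M) = 0"
        by (simp only: zero nn_integral_const mult_zero_left)
      then show ?thesis
        using False by simp
    next
      case True
      have meas: "?F \<in> borel_measurable M"
        by measurable
      have scale: "(\<lambda>q. \<lambda>i\<in>{1..m}. r * q i) \<in> M \<rightarrow>\<^sub>M M"
        unfolding M_def by measurable
      have "(\<integral>\<^sup>+y. ?F y \<partial>M) = ennreal (r ^ m) * (\<integral>\<^sup>+q. ?F (\<lambda>i\<in>{1..m}. r * q i) \<partial>M)"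
        using nn_integral_PiM_lborel_scale[OF finite_atLeastAtMost True meas[unfolded M_def]]
        by (simp only: M_def card_atLeastAtMost diff_Suc_1)
      also have "\<dots> = (\<integral>\<^sup>+q. ennreal (r ^ m) * ?F (\<lambda>i\<in>{1..m}. r * q i) \<partial>M)"
        by (rule nn_integral_cmult[symmetric]) (rule measurable_compose[OF scale meas])
      also have "\<dots> = (\<integral>\<^sup>+q. ?G q \<partial>M)"
      proof (rule nn_integral_cong)
        fix q assume q: "q \<in> space M"
        \<comment> \<open>\<open>x\<close> completes \<open>q\<close> to \<open>n\<close>
          coordinates with sum 1, so that the last kernel is treated like the others.\<close>
        define x where "x = q(n := 1 - (\<Sum>i=1..m. q i))"
        have x: "x n = 1 - (\<Sum>i=1..m. q i)" "\<And>i. i \<in> {1..m} \<Longrightarrow> x i = q i"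
          using n by (auto simp: x_def)
        have "r ^ m * (\<Prod>i=1..n. h i (r * x i)) =
            r ^ m * r powr (\<nu> * B - n) * exp (- ((\<Sum>i=1..n. x i powr \<nu>) * r powr \<nu>)) *
            (\<Prod>i=1..n. indicator {0<..} (x i) * x i powr (\<nu> * \<beta> i - 1))"
          using True by (simp add: h_def B_def prod_gamma_kernel_scale)
        also have "(\<Sum>i=1..n. x i powr \<nu>) = S q"
          unfolding n_set S_def using n x by simp
        also have "(\<Prod>i=1..n. indicator {0<..} (x i) * x i powr (\<nu> * \<beta> i - 1)) =
            indicator (open_simplex m) q * P q"
        proof -
          \<comment> \<open>Positivity of \<open>x n\<close> is the condition that the coordinates
            of \<open>q\<close> sum to less than 1. Membership in \<open>space M\<close>, which is
            part of \<open>open_simplex\<close>, comes from \<open>q\<close>.\<close>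
          have "(\<Prod>i=1..n. indicator {0<..} (x i)) = (indicator (open_simplex m) q :: real)"
          proof (cases "q \<in> open_simplex m")
            case True
            then show ?thesis
              unfolding n_set using n x by (auto simp: open_simplex_def)
          next
            case False
            then have "\<exists>i\<in>{1..n}. \<not> x i > 0"
              unfolding n_set using q x by (auto simp: open_simplex_def M_def)
            then have "(\<Prod>i=1..n. indicator {0<..} (x i)) = (0 :: real)"
              by (intro prod_zero) (auto simp: indicator_def)
            then show ?thesis
              using False by simp
          qed
          moreover have "(\<Prod>i=1..n. x i powr (\<nu> * \<beta> i - 1)) = P q"
            unfolding n_set P_def using n x by (simp add: mult_ac)
          ultimately show ?thesis by (simp add: prod.distrib)
        qed
        \<comment> \<open>The Jacobian \<open>r ^ m\<close> meets the \<open>- n\<close> from the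
          \<open>n\<close> kernels; as \<open>n = Suc m\<close>, the exponent
          \<open>\<nu> * B - 1\<close> of a Gamma integral with parameter \<open>B\<close>
          remains.\<close>
        also have "r ^ m * r powr (\<nu> * B - n) = r powr (\<nu> * B - 1)"
        proof -
          have "r ^ m = r powr real m"
            using True by (simp add: powr_realpow)
          then show ?thesis
            using n by (simp flip: powr_add)
        qed
        finally have *: "r ^ m * (\<Prod>i=1..n. h i (r * x i)) = indicator (open_simplex m) q * P q *
            (indicator {0<..} r * (r powr (\<nu> * B - 1) * exp (- (S q * r powr \<nu>))))"
          using True by (simp add: mult_ac)
        \<comment> \<open>Here \<open>r * x n\<close> is the shifted last argument at the dilated
          point.\<close>
        have "(\<Prod>i=1..n. h i (r * x i)) =
            (\<Prod>i=1..m. h i (r * q i)) * h n (r - (\<Sum>i=1..m. r * q i))"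
          unfolding n_set using n x by (simp add: right_diff_distrib sum_distrib_left mult_ac)
        then have "ennreal (r ^ m) * ?F (\<lambda>i\<in>{1..m}. r * q i) =
            ennreal (r ^ m * (\<Prod>i=1..n. h i (r * x i)))"
          using True by (simp add: ennreal_mult prod_ennreal prod_nonneg h_def)
        then show "ennreal (r ^ m) * ?F (\<lambda>i\<in>{1..m}. r * q i) = ?G q"
          by (simp only: *)
      qed
      finally show ?thesis .
    qed
  qed
  also have "\<dots> = (\<integral>\<^sup>+q. \<integral>\<^sup>+r. ennreal (indicator (open_simplex m) q * P q *
      (indicator {0<..} r * (r powr (\<nu> * B - 1) * exp (- (S q * r powr \<nu>))))) \<partial>lborel \<partial>M)"
    by (rule pair.Fubini') measurable
  also have "\<dots> = (\<integral>\<^sup>+q. ennreal (Gamma B / \<nu>) *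
      ennreal (indicator (open_simplex m) q * (P q * S q powr (- B))) \<partial>M)"
  proof (rule nn_integral_cong)
    fix q
    show "(\<integral>\<^sup>+r. ennreal (indicator (open_simplex m) q * P q *
      (indicator {0<..} r * (r powr (\<nu> * B - 1) * exp (- (S q * r powr \<nu>))))) \<partial>lborel) =
      ennreal (Gamma B / \<nu>) * ennreal (indicator (open_simplex m) q * (P q * S q powr (- B)))"
    proof (cases "q \<in> open_simplex m")
      case True
      have "(\<integral>\<^sup>+r. ennreal (indicator (open_simplex m) q * P q *
          (indicator {0<..} r * (r powr (\<nu> * B - 1) * exp (- (S q * r powr \<nu>))))) \<partial>lborel) =
          ennreal (P q) * ennreal (Gamma B * S q powr (- B) / \<nu>)"
        \<comment> \<open>At fixed \<open>q\<close> the radial integral is the Gamma integral with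
          \<open>a = B\<close> and constant \<open>S q\<close>.\<close>
        unfolding nn_integral_powr_exp_powr[OF B \<nu> S_pos[OF True], symmetric]
        using True P_nonneg[of q] by (subst nn_integral_cmult[symmetric]) (auto simp: ennreal_mult')
      also have "\<dots> = ennreal (Gamma B / \<nu> * (P q * S q powr (- B)))"
        using P_nonneg[of q] by (simp add: mult_ac flip: ennreal_mult')
      also have "\<dots> = ennreal (Gamma B / \<nu>) * ennreal (P q * S q powr (- B))"
        using \<nu> Gamma_real_pos[OF B] by (intro ennreal_mult') simp
      finally show ?thesis
        using True by simp
    qed simp
  qed
  also have "\<dots> = ennreal (Gamma B / \<nu>) *
      (\<integral>\<^sup>+q. ennreal (indicator (open_simplex m) q * (P q * S q powr (- B))) \<partial>M)"
    by (rule nn_integral_cmult) measurable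
  finally have eq: "ennreal (\<Prod>i=1..n. Gamma (\<beta> i) / \<nu>) = ennreal (Gamma B / \<nu>) *
      (\<integral>\<^sup>+q. ennreal (indicator (open_simplex m) q * (P q * S q powr (- B))) \<partial>M)"
    using \<nu> \<beta> by (subst (asm) prod_ennreal) (auto intro!: divide_nonneg_pos less_imp_le Gamma_real_pos)
  \<comment> \<open>For a nonnegative measurable integrand this holds even when the integral is
    infinite: \<open>enn2real\<close> then gives 0, the default value of the Bochner
    integral.\<close>
  have "(LINT q:open_simplex m|M. P q * S q powr (- B)) =
      enn2real (\<integral>\<^sup>+q. ennreal (indicator (open_simplex m) q * (P q * S q powr (- B))) \<partial>M)"
    unfolding set_lebesgue_integral_def using P_nonneg
    by (subst integral_eq_nn_integral) auto
  moreover have "enn2real (ennreal (Gamma B / \<nu>) *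
      (\<integral>\<^sup>+q. ennreal (indicator (open_simplex m) q * (P q * S q powr (- B))) \<partial>M)) =
      (\<Prod>i=1..n. Gamma (\<beta> i) / \<nu>)"
    unfolding eq[symmetric] using \<nu> \<beta>
    by (intro enn2real_ennreal prod_nonneg) (auto intro!: divide_nonneg_pos less_imp_le Gamma_real_pos)
  ultimately have "Gamma B / \<nu> * (LINT q:open_simplex m|M. P q * S q powr (- B)) =
      (\<Prod>i=1..n. Gamma (\<beta> i) / \<nu>)"
    using \<nu> Gamma_real_pos[OF B] by (simp add: enn2real_mult)
  \<comment> \<open>Of the \<open>n\<close> factors \<open>1 / \<nu>\<close> on the right, one
    cancels against the radial integral, leaving \<open>\<nu> ^ m\<close>.\<close>
  then have "(LINT q:open_simplex m|M. P q * S q powr (- B)) =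
      (\<Prod>i=1..n. Gamma (\<beta> i)) / (\<nu> ^ m * Gamma B)"
    using \<nu> Gamma_real_pos[OF B] n by (simp add: prod_dividef field_simps)
  then show ?thesis
    unfolding P_def S_def M_def B_def m_def .
qed

end
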